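(* The algebra $Asp(\mathbb{Z})$ of Asplund functions on the (discrete) group of integers $\mathbb{Z}$ admits uncountably many invariant means.
   Context: A compact $\mathbb{Z}$-system is a compact Hausdorff space $X$ with an action of $\mathbb{Z}$ by homeomorphisms. Let $\mu$ be its unique compatible uniform structure. $X$ is nonsensitive if for every $\varepsilon\in\mu$ there is a nonempty open $O\subset X$ such that $nO\times nO\subset\varepsilon$ for all $n\in\mathbb{Z}$ ($nO$ denotes the image of $O$ under the action of $n$); $X$ is hereditarily nonsensitive (HNS) if every nonempty closed $\mathbb{Z}$-invariant subset is a nonsensitive system. A bounded function $f:\mathbb{Z}\to\mathbb{R}$ is an Asplund function if there are a HNS compact $\mathbb{Z}$-system $X$, a continuous $F:X\to\mathbb{R}$ and $x_0\in X$ with $f(n)=F(nx_0)$ for all $n\in\mathbb{Z}$. $Asp(\mathbb{Z})$ is the algebra of all such functions; it is a uniformly closed translation invariant subalgebra of $\ell_\infty(\mathbb{Z})$ containing the constants. An invariant mean on it is a linear functional $m$ on $Asp(\mathbb{Z})$ with $m(1)=1=\|m\|$ that is invariant under translations $f\mapsto f(n+\cdot)$, $n\in\mathbb{Z}$. *)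

theory Defs
  imports "HOL-Analysis.Analysis"
begin

section \<open>The uniform structure of a compact Hausdorff space\<close>

text \<open>Carrier-relative counterparts of the axioms of the type classes \<open>uniform_space\<close> and
  \<open>open_uniformity\<close>.\<close>

definition uniform_structure :: "'a set \<Rightarrow> ('a \<times> 'a) filter \<Rightarrow> bool" where
  "uniform_structure S U \<longleftrightarrow>
     U \<le> principal (S \<times> S) \<and>
     (\<forall>E. eventually E U \<longrightarrow> (\<forall>x\<in>S. E (x, x))) \<and>
     (\<forall>E. eventually E U \<longrightarrow> eventually (\<lambda>(x, y). E (y, x)) U) \<and>
     (\<forall>E. eventually E U \<longrightarrow>
        (\<exists>D. eventually D U \<and> (\<forall>x y z. D (x, y) \<longrightarrow> D (y, z) \<longrightarrow> E (x, z))))"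

definition compatible_uniform_structure :: "'a topology \<Rightarrow> ('a \<times> 'a) filter \<Rightarrow> bool" where
  "compatible_uniform_structure X U \<longleftrightarrow>
     uniform_structure (topspace X) U \<and>
     (\<forall>V. openin X V \<longleftrightarrow>
        V \<subseteq> topspace X \<and> (\<forall>x\<in>V. eventually (\<lambda>(x', y). x' = x \<longrightarrow> y \<in> V) U))"

text \<open>Well defined for compact Hausdorff spaces by \<open>ex1_compatible_uniform_structure\<close> below.\<close>

definition the_uniformity :: "'a topology \<Rightarrow> ('a \<times> 'a) filter" where
  "the_uniformity X = (THE U. compatible_uniform_structure X U)"


section \<open>Compact \<open>\<int>\<close>-systems and nonsensitivity\<close>

definition compact_Z_system :: "'a topology \<Rightarrow> (int \<Rightarrow> 'a \<Rightarrow> 'a) \<Rightarrow> bool" where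
  "compact_Z_system X act \<longleftrightarrow>
     compact_space X \<and> Hausdorff_space X \<and>
     (\<forall>n. homeomorphic_map X X (act n)) \<and>
     (\<forall>x\<in>topspace X. act 0 x = x) \<and>
     (\<forall>m n. \<forall>x\<in>topspace X. act (m + n) x = act m (act n x))"

definition nonsensitive :: "'a topology \<Rightarrow> (int \<Rightarrow> 'a \<Rightarrow> 'a) \<Rightarrow> bool" where
  "nonsensitive X act \<longleftrightarrow>
     (\<forall>E. eventually (\<lambda>p. p \<in> E) (the_uniformity X) \<longrightarrow>
        (\<exists>V. openin X V \<and> V \<noteq> {} \<and> (\<forall>n. (act n ` V) \<times> (act n ` V) \<subseteq> E)))"

definition HNS :: "'a topology \<Rightarrow> (int \<Rightarrow> 'a \<Rightarrow> 'a) \<Rightarrow> bool" where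
  "HNS X act \<longleftrightarrow>
     (\<forall>Y. closedin X Y \<and> Y \<noteq> {} \<and> (\<forall>n. act n ` Y \<subseteq> Y) \<longrightarrow>
        nonsensitive (subtopology X Y) act)"


section \<open>Asplund functions\<close>

definition Asplund_via :: "'a topology \<Rightarrow> (int \<Rightarrow> 'a \<Rightarrow> 'a) \<Rightarrow> (int \<Rightarrow> real) \<Rightarrow> bool" where
  "Asplund_via X act f \<longleftrightarrow>
     compact_Z_system X act \<and> HNS X act \<and>
     (\<exists>F x0. continuous_map X euclideanreal F \<and> x0 \<in> topspace X \<and> (\<forall>n. f n = F (act n x0)))"

text \<open>HOL cannot quantify over types inside a formula, so the systems range over all topologies
  with carrier contained in \<open>int set set\<close>. This loses nothing: the lemma \<open>Asplund_via_imp_Asp\<close>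
  below shows that every function obtained from a system on an arbitrary type belongs to \<open>Asp\<close>
  (replace the system by the closure of the orbit of \<open>x0\<close>, which has at most
  \<open>2^(2^\<aleph>\<^sub>0)\<close> points).\<close>

definition Asp :: "(int \<Rightarrow> real) set" where
  "Asp = {f. bounded (range f) \<and> (\<exists>(X :: int set set topology) act. Asplund_via X act f)}"


section \<open>Invariant means\<close>

definition sup_norm :: "(int \<Rightarrow> real) \<Rightarrow> real" where
  "sup_norm f = (SUP k. \<bar>f k\<bar>)"

text \<open>Extended-real valued, so that an unbounded functional has norm \<open>\<infinity>\<close>.\<close>

definition functional_norm :: "(int \<Rightarrow> real) set \<Rightarrow> ((int \<Rightarrow> real) \<Rightarrow> real) \<Rightarrow> ereal" where
  "functional_norm A m = (SUP f\<in>{f \<in> A. sup_norm f \<le> 1}. ereal \<bar>m f\<bar>)"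

text \<open>Membership in \<open>extensional A\<close> makes a functional on \<open>A\<close> correspond to exactly one HOL
  function; without it, means could differ by their irrelevant values outside \<open>A\<close>.\<close>

definition invariant_mean :: "(int \<Rightarrow> real) set \<Rightarrow> ((int \<Rightarrow> real) \<Rightarrow> real) \<Rightarrow> bool" where
  "invariant_mean A m \<longleftrightarrow>
     m \<in> extensional A \<and>
     (\<forall>f\<in>A. \<forall>g\<in>A. m (\<lambda>k. f k + g k) = m f + m g) \<and>
     (\<forall>c. \<forall>f\<in>A. m (\<lambda>k. c * f k) = c * m f) \<and>
     m (\<lambda>_. 1) = 1 \<and>
     functional_norm A m = 1 \<and>
     (\<forall>n. \<forall>f\<in>A. m (\<lambda>k. f (n + k)) = m f)"


section \<open>Existence and uniqueness of the compatible uniform structure\<close>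

definition diagonal_nbhd :: "'a topology \<Rightarrow> ('a \<times> 'a \<Rightarrow> bool) \<Rightarrow> bool" where
  "diagonal_nbhd X P \<longleftrightarrow>
     (\<exists>W. openin (prod_topology X X) W \<and> (\<forall>x\<in>topspace X. (x, x) \<in> W) \<and> (\<forall>p\<in>W. P p))"

lemma diagonal_nbhd_square:
  assumes "openin (prod_topology X X) W" "(x, x) \<in> W"
  obtains V where "openin X V" "x \<in> V" "V \<times> V \<subseteq> W"
proof -
  obtain A B where AB: "openin X A" "openin X B" "x \<in> A" "x \<in> B" "A \<times> B \<subseteq> W"
    using assms unfolding openin_prod_topology_alt by metis
  have "openin X (A \<inter> B)" using AB by blast
  moreover have "x \<in> A \<inter> B" using AB by blast
  moreover have "(A \<inter> B) \<times> (A \<inter> B) \<subseteq> W" using AB(5) by blast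
  ultimately show thesis by (rule that)
qed

lemma compatible_interior:
  assumes U: "compatible_uniform_structure X U"
    and P: "eventually P U" and x: "x \<in> topspace X"
  obtains B where "openin X B" "x \<in> B" "\<And>y. y \<in> B \<Longrightarrow> P (x, y)"
proof -
  let ?N = "\<lambda>Q y. eventually (\<lambda>(y', z). y' = y \<longrightarrow> Q z) U"
  have us: "uniform_structure (topspace X) U"
    and op: "\<And>V. openin X V \<longleftrightarrow> V \<subseteq> topspace X \<and> (\<forall>x\<in>V. ?N (\<lambda>y. y \<in> V) x)"
    using U unfolding compatible_uniform_structure_def by blast+
  have carrier: "eventually (\<lambda>p. p \<in> topspace X \<times> topspace X) U"
    using us unfolding uniform_structure_def by (simp add: le_principal)
  define Q where "Q = (\<lambda>z. P (x, z))"
  define B where "B = {y \<in> topspace X. ?N Q y}"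
  have step: "?N (?N Q) y" if y: "?N Q y" for y
  proof -
    obtain D where D: "eventually D U"
      and DD: "\<And>a b c. D (a, b) \<Longrightarrow> D (b, c) \<Longrightarrow> (case (a, c) of (y', z) \<Rightarrow> y' = y \<longrightarrow> Q z)"
      using us y unfolding uniform_structure_def by metis
    from D show ?thesis
    proof (rule eventually_mono)
      fix p assume p: "D p"
      show "case p of (y', z) \<Rightarrow> y' = y \<longrightarrow> ?N Q z"
      proof (clarify)
        fix y' z assume pz: "p = (y, z)"
        from D show "?N Q z"
          by (rule eventually_mono) (use DD p pz in auto)
      qed
    qed
  qed
  have "openin X B"
    unfolding op
  proof (intro conjI ballI)
    show "B \<subseteq> topspace X" by (auto simp: B_def)
    fix y assume "y \<in> B"
    then have "?N (?N Q) y" using step by (auto simp: B_def)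
    then show "?N (\<lambda>z. z \<in> B) y"
      using carrier by eventually_elim (auto simp: B_def)
  qed
  moreover have "x \<in> B"
    using x P by (auto simp: B_def Q_def elim: eventually_mono)
  moreover have "P (x, y)" if "y \<in> B" for y
  proof -
    have y: "y \<in> topspace X" "?N Q y" using that by (auto simp: B_def)
    then have "(case (y, y) of (y', z) \<Rightarrow> y' = y \<longrightarrow> Q z)"
      using us unfolding uniform_structure_def by blast
    then show ?thesis by (simp add: Q_def)
  qed
  ultimately show thesis using that by blast
qed

lemma eventually_compatible_uniform_structure:
  assumes X: "compact_space X" and U: "compatible_uniform_structure X U"
  shows "eventually P U \<longleftrightarrow> diagonal_nbhd X P"
proof -
  have us: "uniform_structure (topspace X) U"
    and op: "\<And>V. openin X V \<longleftrightarrow> V \<subseteq> topspace X \<and>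
               (\<forall>x\<in>V. eventually (\<lambda>(x', y). x' = x \<longrightarrow> y \<in> V) U)"
    using U unfolding compatible_uniform_structure_def by blast+
  have carrier: "eventually (\<lambda>p. p \<in> topspace X \<times> topspace X) U"
    using us unfolding uniform_structure_def by (simp add: le_principal)
  show ?thesis
  proof
    assume P: "eventually P U"
    obtain D where D: "eventually D U" and DP: "\<And>x y z. D (x, y) \<Longrightarrow> D (y, z) \<Longrightarrow> P (x, z)"
      using us P unfolding uniform_structure_def by metis
    have D2: "eventually (\<lambda>(x, y). D (y, x)) U"
      using us D unfolding uniform_structure_def by blast
    have D': "eventually (\<lambda>p. D p \<and> (case p of (x, y) \<Rightarrow> D (y, x))) U"
      using D D2 by (rule eventually_conj)
    have "\<forall>x\<in>topspace X. \<exists>B. openin X B \<and> x \<in> B \<and> (\<forall>y\<in>B. D (x, y) \<and> D (y, x))"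
    proof
      fix x assume x: "x \<in> topspace X"
      show "\<exists>B. openin X B \<and> x \<in> B \<and> (\<forall>y\<in>B. D (x, y) \<and> D (y, x))"
        proof -
        obtain B where "openin X B" "x \<in> B"
          "\<And>y. y \<in> B \<Longrightarrow> D (x, y) \<and> (case (x, y) of (x, y) \<Rightarrow> D (y, x))"
          using compatible_interior[OF U D' x] by metis
        then show ?thesis by auto
      qed
    qed
    then obtain B where B: "\<And>x. x \<in> topspace X \<Longrightarrow> openin X (B x) \<and> x \<in> B x \<and>
        (\<forall>y\<in>B x. D (x, y) \<and> D (y, x))"
      by metis
    show "diagonal_nbhd X P"
      unfolding diagonal_nbhd_def
    proof (intro exI conjI ballI)
      show "openin (prod_topology X X) (\<Union>x\<in>topspace X. B x \<times> B x)"
        by (rule openin_Union) (auto simp: openin_prod_Times_iff B)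
      show "(x, x) \<in> (\<Union>x\<in>topspace X. B x \<times> B x)" if "x \<in> topspace X" for x
        using B[OF that] that by blast
      fix p assume "p \<in> (\<Union>x\<in>topspace X. B x \<times> B x)"
      then obtain x y z where "x \<in> topspace X" "p = (y, z)" "y \<in> B x" "z \<in> B x" by blast
      then show "P p" using B[of x] DP[of y x z] by blast
    qed
  next
    assume "diagonal_nbhd X P"
    then obtain W where W: "openin (prod_topology X X) W"
      "\<And>x. x \<in> topspace X \<Longrightarrow> (x, x) \<in> W" "\<And>p. p \<in> W \<Longrightarrow> P p"
      unfolding diagonal_nbhd_def by blast
    have "\<exists>D B V. eventually D U \<and> openin X B \<and> x \<in> B \<and> V \<times> V \<subseteq> W \<and>
        (\<forall>y\<in>B. y \<in> V \<and> (\<forall>z. D (y, z) \<longrightarrow> z \<in> V))" if x: "x \<in> topspace X" for x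
    proof -
      obtain V where V: "openin X V" "x \<in> V" "V \<times> V \<subseteq> W"
        using diagonal_nbhd_square[OF W(1) W(2)[OF x]] .
      then have "eventually (\<lambda>(x', y). x' = x \<longrightarrow> y \<in> V) U" using op by blast
      then obtain D where D: "eventually D U"
        and DD: "\<And>a b c. D (a, b) \<Longrightarrow> D (b, c) \<Longrightarrow> (case (a, c) of (x', y) \<Rightarrow> x' = x \<longrightarrow> y \<in> V)"
        using us unfolding uniform_structure_def by metis
      obtain B where B: "openin X B" "x \<in> B" "\<And>y. y \<in> B \<Longrightarrow> D (x, y)"
        using compatible_interior[OF U D x] by blast
      have Dyy: "D (y, y)" if "y \<in> B" for y
        using us D that openin_subset[OF B(1)] unfolding uniform_structure_def by blast
      have BV: "z \<in> V" if "y \<in> B" "D (y, z)" for y z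
        using DD[OF B(3)[OF that(1)] that(2)] by simp
      show ?thesis
        by (intro exI[of _ D] exI[of _ B] exI[of _ V]) (use D B V BV Dyy in auto)
    qed
    then obtain D B V where DBV: "\<And>x. x \<in> topspace X \<Longrightarrow> eventually (D x) U \<and> openin X (B x) \<and>
        x \<in> B x \<and> V x \<times> V x \<subseteq> W \<and> (\<forall>y\<in>B x. y \<in> V x \<and> (\<forall>z. D x (y, z) \<longrightarrow> z \<in> V x))"
      by metis
    have "\<exists>T. finite T \<and> T \<subseteq> topspace X \<and> topspace X \<subseteq> \<Union> (B ` T)"
    proof -
      have "compactin X (topspace X)" using X by (simp add: compact_space_def)
      moreover have "\<And>C. C \<in> B ` topspace X \<Longrightarrow> openin X C" using DBV by blast
      moreover have "topspace X \<subseteq> \<Union> (B ` topspace X)" using DBV by blast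
      ultimately obtain F where "finite F" "F \<subseteq> B ` topspace X" "topspace X \<subseteq> \<Union> F"
        by (meson compactinD)
      then show ?thesis by (metis finite_subset_image)
    qed
    then obtain T where T: "finite T" "T \<subseteq> topspace X" "topspace X \<subseteq> \<Union> (B ` T)" by blast
    have "eventually (\<lambda>p. \<forall>t\<in>T. D t p) U"
      using T DBV by (intro eventually_ball_finite) auto
    then show "eventually P U"
      using carrier
    proof eventually_elim
      case (elim p)
      obtain y z where p: "p = (y, z)" by force
      then obtain t where "t \<in> T" "y \<in> B t" using elim T by blast
      then have "y \<in> V t" "z \<in> V t" "V t \<times> V t \<subseteq> W" using DBV[of t] T elim p by blast+
      then show ?case using W(3) p by blast
    qed
  qed
qed

lemma is_filter_diagonal_nbhd: "is_filter (diagonal_nbhd X)"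
proof
  show "diagonal_nbhd X (\<lambda>x. True)"
    unfolding diagonal_nbhd_def
    by (rule exI[of _ "topspace X \<times> topspace X"]) (auto simp: openin_prod_Times_iff)
  fix P Q :: "'a \<times> 'a \<Rightarrow> bool"
  assume "diagonal_nbhd X P" "diagonal_nbhd X Q"
  then obtain V W where "openin (prod_topology X X) V" "\<forall>x\<in>topspace X. (x, x) \<in> V" "\<forall>p\<in>V. P p"
    "openin (prod_topology X X) W" "\<forall>x\<in>topspace X. (x, x) \<in> W" "\<forall>p\<in>W. Q p"
    unfolding diagonal_nbhd_def by metis
  then show "diagonal_nbhd X (\<lambda>x. P x \<and> Q x)"
    unfolding diagonal_nbhd_def by (intro exI[of _ "V \<inter> W"]) auto
next
  fix P Q :: "'a \<times> 'a \<Rightarrow> bool"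
  assume "\<forall>x. P x \<longrightarrow> Q x" "diagonal_nbhd X P"
  then show "diagonal_nbhd X Q" unfolding diagonal_nbhd_def by metis
qed

lemma diagonal_nbhd_trans:
  assumes X: "compact_space X" "Hausdorff_space X" and P: "diagonal_nbhd X P"
  shows "\<exists>D. diagonal_nbhd X D \<and> (\<forall>x y z. D (x, y) \<longrightarrow> D (y, z) \<longrightarrow> P (x, z))"
proof -
  obtain W where W: "openin (prod_topology X X) W"
    "\<And>x. x \<in> topspace X \<Longrightarrow> (x, x) \<in> W" "\<And>p. p \<in> W \<Longrightarrow> P p"
    using P unfolding diagonal_nbhd_def by metis
  have reg: "regular_space X" using X compact_Hausdorff_imp_regular_space by blast
  have "\<exists>G K V. openin X G \<and> closedin X K \<and> openin X V \<and> x \<in> G \<and> G \<subseteq> K \<and> K \<subseteq> V \<and> V \<times> V \<subseteq> W"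
    if x: "x \<in> topspace X" for x
  proof -
    obtain V where V: "openin X V" "x \<in> V" "V \<times> V \<subseteq> W"
      using diagonal_nbhd_square[OF W(1) W(2)[OF x]] .
    then obtain G K where "openin X G" "closedin X K" "x \<in> G" "G \<subseteq> K" "K \<subseteq> V"
      using reg unfolding neighbourhood_base_of_closedin[symmetric] neighbourhood_base_of by metis
    then show ?thesis using V by blast
  qed
  then obtain G K V where GKV: "\<And>x. x \<in> topspace X \<Longrightarrow> openin X (G x) \<and> closedin X (K x) \<and>
      openin X (V x) \<and> x \<in> G x \<and> G x \<subseteq> K x \<and> K x \<subseteq> V x \<and> V x \<times> V x \<subseteq> W"
    by metis
  have "\<exists>T. finite T \<and> T \<subseteq> topspace X \<and> topspace X \<subseteq> \<Union> (G ` T)"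
  proof -
    have "compactin X (topspace X)" using X by (simp add: compact_space_def)
    moreover have "\<And>C. C \<in> G ` topspace X \<Longrightarrow> openin X C" using GKV by blast
    moreover have "topspace X \<subseteq> \<Union> (G ` topspace X)" using GKV by blast
    ultimately obtain F where "finite F" "F \<subseteq> G ` topspace X" "topspace X \<subseteq> \<Union> F"
      by (meson compactinD)
    then show ?thesis by (metis finite_subset_image)
  qed
  then obtain T where T: "finite T" "T \<subseteq> topspace X" "topspace X \<subseteq> \<Union> (G ` T)" by blast
  define S where "S = topspace X"
  define Dt where "Dt = (\<lambda>t. (V t \<times> V t) \<union> ((S - K t) \<times> (S - K t)))"
  define D where "D = topspace (prod_topology X X) \<inter> (\<Inter>t\<in>T. Dt t)"
  have Dt: "openin (prod_topology X X) (Dt t)" if "t \<in> T" for t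
  proof -
    have "openin X (V t)" "openin X (S - K t)"
      using GKV[of t] T(2) that unfolding S_def by blast+
    then show ?thesis unfolding Dt_def by (intro openin_Un) (simp_all add: openin_prod_Times_iff)
  qed
  have "openin (prod_topology X X) D"
  proof (cases "T = {}")
    case True then show ?thesis unfolding D_def by (simp add: openin_prod_Times_iff)
  next
    case False then show ?thesis unfolding D_def using Dt T
      by (intro openin_Int openin_topspace openin_INT2) auto
  qed
  moreover have "(x, x) \<in> D" if x: "x \<in> topspace X" for x
  proof -
    have "(x, x) \<in> Dt t" if "t \<in> T" for t
      using GKV[of t] T(2) that x by (auto simp: Dt_def S_def)
    then show ?thesis using x by (simp add: D_def)
  qed
  moreover have "P (x, z)" if "(x, y) \<in> D" "(y, z) \<in> D" for x y z
  proof -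
    have "y \<in> topspace X" using that by (auto simp: D_def)
    then obtain t where t: "t \<in> T" "y \<in> G t" using T by blast
    then have "y \<in> K t" and tX: "t \<in> topspace X" using GKV[of t] T by blast+
    moreover have "(x, y) \<in> Dt t" "(y, z) \<in> Dt t" using that t by (auto simp: D_def)
    ultimately have "x \<in> V t" "z \<in> V t" by (auto simp: Dt_def)
    then show ?thesis using GKV[OF tX] W(3) by blast
  qed
  ultimately show ?thesis
    unfolding diagonal_nbhd_def by (intro exI[of _ "\<lambda>p. p \<in> D"]) blast
qed

lemma ex_compatible_uniform_structure:
  assumes X: "compact_space X" "Hausdorff_space X"
  shows "compatible_uniform_structure X (Abs_filter (diagonal_nbhd X))"
proof -
  define U where "U = Abs_filter (diagonal_nbhd X)"
  have ev: "eventually P U \<longleftrightarrow> diagonal_nbhd X P" for P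
    unfolding U_def by (rule eventually_Abs_filter[OF is_filter_diagonal_nbhd])
  have "uniform_structure (topspace X) U"
    unfolding uniform_structure_def
  proof (intro conjI allI impI)
    have "diagonal_nbhd X (\<lambda>p. p \<in> topspace X \<times> topspace X)"
      unfolding diagonal_nbhd_def
      by (rule exI[of _ "topspace X \<times> topspace X"]) (auto simp: openin_prod_Times_iff)
    then show "U \<le> principal (topspace X \<times> topspace X)"
      by (simp add: le_principal ev)
  next
    fix E assume "eventually E U"
    then show "\<forall>x\<in>topspace X. E (x, x)" unfolding ev diagonal_nbhd_def by blast
  next
    fix E assume "eventually E U"
    then obtain W where W: "openin (prod_topology X X) W"
      "\<And>x. x \<in> topspace X \<Longrightarrow> (x, x) \<in> W" "\<And>p. p \<in> W \<Longrightarrow> E p"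
      unfolding ev diagonal_nbhd_def by metis
    let ?W = "{p \<in> topspace (prod_topology X X). (snd p, fst p) \<in> W}"
    have "continuous_map (prod_topology X X) (prod_topology X X) (\<lambda>p. (snd p, fst p))"
      by (intro continuous_map_pairedI continuous_map_fst continuous_map_snd)
    then have "openin (prod_topology X X) ?W"
      using W(1) by (rule openin_continuous_map_preimage)
    then show "eventually (\<lambda>(x, y). E (y, x)) U"
      unfolding ev diagonal_nbhd_def using W by (intro exI[of _ ?W]) auto
  next
    fix E assume "eventually E U"
    then show "\<exists>D. eventually D U \<and> (\<forall>x y z. D (x, y) \<longrightarrow> D (y, z) \<longrightarrow> E (x, z))"
      unfolding ev by (rule diagonal_nbhd_trans[OF X])
  qed
  moreover have "openin X V \<longleftrightarrow> V \<subseteq> topspace X \<and>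
      (\<forall>x\<in>V. eventually (\<lambda>(x', y). x' = x \<longrightarrow> y \<in> V) U)" for V
  proof (intro iffI conjI ballI)
    assume V: "openin X V"
    then show "V \<subseteq> topspace X" by (rule openin_subset)
    fix x assume x: "x \<in> V"
    let ?W = "(V \<times> V) \<union> ((topspace X - {x}) \<times> topspace X)"
    have "x \<in> topspace X" using V x openin_subset by blast
    then have "closedin X {x}" using X by (simp add: closedin_Hausdorff_singleton)
    then have "openin (prod_topology X X) ?W"
      using V by (intro openin_Un) (auto simp: openin_prod_Times_iff)
    then show "eventually (\<lambda>(x', y). x' = x \<longrightarrow> y \<in> V) U"
      unfolding ev diagonal_nbhd_def using x by (intro exI[of _ ?W]) auto
  next
    assume V: "V \<subseteq> topspace X \<and> (\<forall>x\<in>V. eventually (\<lambda>(x', y). x' = x \<longrightarrow> y \<in> V) U)"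
    have "\<exists>B. openin X B \<and> x \<in> B \<and> B \<subseteq> V" if x: "x \<in> V" for x
    proof -
      obtain W where W: "openin (prod_topology X X) W"
        "\<And>x. x \<in> topspace X \<Longrightarrow> (x, x) \<in> W" "\<And>p. p \<in> W \<Longrightarrow> (case p of (x', y) \<Rightarrow> x' = x \<longrightarrow> y \<in> V)"
        using bspec[OF conjunct2[OF V] x] unfolding ev diagonal_nbhd_def by metis
      have xX: "x \<in> topspace X" using V x by blast
      then obtain B where "openin X B" "x \<in> B" "B \<times> B \<subseteq> W"
        using diagonal_nbhd_square[OF W(1) W(2)[OF xX]] by metis
      then have "B \<subseteq> V" using W(3) by blast
      then show ?thesis using \<open>openin X B\<close> \<open>x \<in> B\<close> by blast
    qed
    then show "openin X V" using openin_subopen by metis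
  qed
  ultimately show ?thesis unfolding compatible_uniform_structure_def U_def by blast
qed

theorem ex1_compatible_uniform_structure:
  assumes X: "compact_space X" "Hausdorff_space X"
  shows "\<exists>!U. compatible_uniform_structure X U"
proof (rule ex_ex1I)
  show "\<exists>U. compatible_uniform_structure X U"
    using ex_compatible_uniform_structure[OF X] by blast
  show "U = U'" if "compatible_uniform_structure X U" "compatible_uniform_structure X U'" for U U'
    unfolding filter_eq_iff using eventually_compatible_uniform_structure[OF X(1)] that by blast
qed

corollary eventually_the_uniformity:
  assumes X: "compact_space X" "Hausdorff_space X"
  shows "eventually P (the_uniformity X) \<longleftrightarrow> diagonal_nbhd X P"
  using eventually_compatible_uniform_structure[OF X(1)]
    theI'[OF ex1_compatible_uniform_structure[OF X]]
  unfolding the_uniformity_def by blast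


section \<open>Independence of the type underlying the system\<close>

lemma nonsensitive_transfer:
  assumes X: "compact_space X" "Hausdorff_space X" and h: "homeomorphic_map X X' h"
    and eq: "\<And>n x. x \<in> topspace X \<Longrightarrow> act' n (h x) = h (act n x)"
    and inv: "\<And>n x. x \<in> topspace X \<Longrightarrow> act n x \<in> topspace X"
    and ns: "nonsensitive X act"
  shows "nonsensitive X' act'"
proof -
  have hs: "X homeomorphic_space X'" using h homeomorphic_map_imp_homeomorphic_space by blast
  have X': "compact_space X'" "Hausdorff_space X'"
    using X hs homeomorphic_compact_space homeomorphic_Hausdorff_space by blast+
  have hc: "continuous_map X X' h" using h homeomorphic_imp_continuous_map by blast
  show ?thesis
    unfolding nonsensitive_def
  proof (intro allI impI)
    fix E assume "eventually (\<lambda>p. p \<in> E) (the_uniformity X')"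
    then obtain W where W: "openin (prod_topology X' X') W"
      "\<And>x. x \<in> topspace X' \<Longrightarrow> (x, x) \<in> W" "W \<subseteq> E"
      unfolding eventually_the_uniformity[OF X'] diagonal_nbhd_def by blast
    let ?W = "{p \<in> topspace (prod_topology X X). (h (fst p), h (snd p)) \<in> W}"
    have "continuous_map (prod_topology X X) (prod_topology X' X') (\<lambda>p. (h (fst p), h (snd p)))"
      using hc by (intro continuous_map_pairedI)
        (auto intro: continuous_map_compose[OF continuous_map_fst, unfolded o_def]
          continuous_map_compose[OF continuous_map_snd, unfolded o_def])
    then have "openin (prod_topology X X) ?W"
      using W(1) by (rule openin_continuous_map_preimage)
    moreover have "(x, x) \<in> ?W" if "x \<in> topspace X" for x
      using that W(2) hc by (auto simp: continuous_map_def)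
    ultimately have "eventually (\<lambda>p. p \<in> ?W) (the_uniformity X)"
      unfolding eventually_the_uniformity[OF X] diagonal_nbhd_def by blast
    then obtain V where V: "openin X V" "V \<noteq> {}" "\<And>n. (act n ` V) \<times> (act n ` V) \<subseteq> ?W"
      using ns[unfolded nonsensitive_def, rule_format, of ?W] by blast
    have VX: "V \<subseteq> topspace X" using V(1) by (rule openin_subset)
    have "openin X' (h ` V)" using h V(1) VX homeomorphic_map_openness by blast
    moreover have "(act' n ` h ` V) \<times> (act' n ` h ` V) \<subseteq> E" for n
    proof (clarify)
      fix x y assume xy: "x \<in> V" "y \<in> V"
      then have "(act n x, act n y) \<in> ?W" using V(3) by blast
      then show "(act' n (h x), act' n (h y)) \<in> E"
        using W(3) xy VX by (auto simp: eq subset_iff)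
    qed
    ultimately show "\<exists>V. openin X' V \<and> V \<noteq> {} \<and> (\<forall>n. (act' n ` V) \<times> (act' n ` V) \<subseteq> E)"
      using V(2) by blast
  qed
qed

lemma HNS_subsystem:
  assumes "HNS X act" "closedin X Y"
  shows "HNS (subtopology X Y) act"
  unfolding HNS_def
proof (intro allI impI)
  fix Z assume Z: "closedin (subtopology X Y) Z \<and> Z \<noteq> {} \<and> (\<forall>n. act n ` Z \<subseteq> Z)"
  then have "closedin X Z" using assms(2) closedin_trans_full by blast
  moreover have "Y \<inter> Z = Z" using Z closedin_imp_subset by blast
  ultimately show "nonsensitive (subtopology (subtopology X Y) Z) act"
    using assms(1) Z unfolding HNS_def by (simp add: subtopology_subtopology)
qed

lemma HNS_transfer:
  assumes X: "compact_space X" "Hausdorff_space X" and h: "homeomorphic_map X X' h"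
    and eq: "\<And>n x. x \<in> topspace X \<Longrightarrow> act' n (h x) = h (act n x)"
    and inv: "\<And>n x. x \<in> topspace X \<Longrightarrow> act n x \<in> topspace X"
    and H: "HNS X act"
  shows "HNS X' act'"
  unfolding HNS_def
proof (intro allI impI)
  fix Y' assume Y': "closedin X' Y' \<and> Y' \<noteq> {} \<and> (\<forall>n. act' n ` Y' \<subseteq> Y')"
  define Y where "Y = {x \<in> topspace X. h x \<in> Y'}"
  have hc: "continuous_map X X' h" using h homeomorphic_imp_continuous_map by blast
  have hX: "h ` topspace X = topspace X'" using h homeomorphic_imp_surjective_map by blast
  have hY: "h ` Y = Y'" using hX Y' closedin_subset unfolding Y_def by fast
  have Y: "closedin X Y" unfolding Y_def using hc Y' closedin_continuous_map_preimage by blast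
  have YX: "Y \<subseteq> topspace X" by (auto simp: Y_def)
  have invY: "act n x \<in> Y" if "x \<in> Y" for n x
  proof -
    have "act' n (h x) \<in> Y'" using Y' that by (auto simp: Y_def)
    then show ?thesis using that inv eq by (auto simp: Y_def)
  qed
  have hh: "homeomorphic_map (subtopology X Y) (subtopology X' Y') h"
    by (rule homeomorphic_map_subtopologies[OF h]) (use hY YX closedin_subset Y' in blast)
  have "nonsensitive (subtopology X Y) act"
    using H Y hY Y' invY unfolding HNS_def by (metis image_empty image_subsetI)
  moreover have cY: "compact_space (subtopology X Y)"
    using X Y closedin_compact_space compact_space_subtopology by blast
  moreover have HY: "Hausdorff_space (subtopology X Y)"
    using X Hausdorff_space_subtopology by blast
  ultimately show "nonsensitive (subtopology X' Y') act'"
    by (intro nonsensitive_transfer[OF cY HY hh]) (use eq inv invY in auto)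
qed

theorem Asplund_via_imp_Asp:
  fixes X :: "'a topology"
  assumes f: "Asplund_via X act f"
  shows "f \<in> Asp"
proof -
  obtain F x0 where sys: "compact_Z_system X act" and H: "HNS X act"
    and F: "continuous_map X euclideanreal F" and x0: "x0 \<in> topspace X"
    and fF: "\<And>n. f n = F (act n x0)"
    using f unfolding Asplund_via_def by blast
  have X: "compact_space X" "Hausdorff_space X" and hom: "\<And>n. homeomorphic_map X X (act n)"
    and act0: "\<And>x. x \<in> topspace X \<Longrightarrow> act 0 x = x"
    and act_add: "\<And>m n x. x \<in> topspace X \<Longrightarrow> act (m + n) x = act m (act n x)"
    using sys unfolding compact_Z_system_def by blast+
  have actX: "act n x \<in> topspace X" if "x \<in> topspace X" for n x
    using hom[of n] that homeomorphic_imp_surjective_map by blast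
  have bdd: "bounded (range f)"
  proof -
    have "compactin euclideanreal (F ` topspace X)"
      using F X image_compactin compact_space_def by blast
    then have "bounded (F ` topspace X)" by (simp add: compact_imp_bounded)
    moreover have "range f \<subseteq> F ` topspace X" using fF actX x0 by auto
    ultimately show ?thesis using bounded_subset by blast
  qed
  define orb where "orb = range (\<lambda>n. act n x0)"
  define Y where "Y = X closure_of orb"
  have orbX: "orb \<subseteq> topspace X" using actX x0 by (auto simp: orb_def)
  have Y: "closedin X Y" "Y \<subseteq> topspace X" "orb \<subseteq> Y"
    unfolding Y_def
    using closure_of_subset[OF orbX] by (auto intro: subsetD[OF closure_of_subset_topspace])
  have x0Y: "x0 \<in> Y" using Y(3) act0[OF x0] unfolding orb_def by (metis rangeI subsetD)
  have actY: "act n ` Y \<subseteq> Y" for n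
  proof -
    have "act n ` (X closure_of orb) \<subseteq> X closure_of (act n ` orb)"
      using continuous_map_image_closure_subset[OF homeomorphic_imp_continuous_map[OF hom[of n]]] .
    moreover have "act n ` orb \<subseteq> orb"
      unfolding orb_def by (auto simp: act_add[OF x0, symmetric])
    ultimately show ?thesis unfolding Y_def by (meson closure_of_mono order_trans)
  qed
  have actY_eq: "act n ` Y = Y" for n
  proof
    show "Y \<subseteq> act n ` Y"
    proof
      fix y assume y: "y \<in> Y"
      then have "act n (act (- n) y) = y" using act_add[of y n "- n"] act0 Y by auto
      then show "y \<in> act n ` Y" using actY[of "- n"] y by (metis imageI subsetD)
    qed
  qed (rule actY)
  define XY where "XY = subtopology X Y"
  have topXY: "topspace XY = Y" using Y by (auto simp: XY_def)
  have XY: "compact_space XY" "Hausdorff_space XY"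
    using X Y closedin_compact_space compact_space_subtopology Hausdorff_space_subtopology
    unfolding XY_def by blast+
  have HY: "HNS XY act" unfolding XY_def using H Y by (intro HNS_subsystem)
  have homY: "homeomorphic_map XY XY (act n)" for n
    unfolding XY_def by (rule homeomorphic_map_subtopologies[OF hom]) (use actY_eq[of n] Y in blast)

  define g :: "'a \<Rightarrow> int set set" where
    "g = (\<lambda>x. {A. x \<in> X closure_of ((\<lambda>n. act n x0) ` A)})"
  have inj: "inj_on g Y"
  proof (rule inj_onI, rule ccontr)
    fix x y assume xy: "x \<in> Y" "y \<in> Y" "g x = g y" "x \<noteq> y"
    have xyX: "x \<in> topspace X" "y \<in> topspace X" using xy Y(2) by blast+
    obtain V V' where V: "openin X V" "openin X V'" "x \<in> V" "y \<in> V'" "disjnt V V'"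
      using X(2) xyX xy(4) unfolding Hausdorff_space_def by metis
    define A where "A = {n. act n x0 \<in> V}"
    have "x \<in> X closure_of ((\<lambda>n. act n x0) ` A)"
      unfolding in_closure_of
    proof (intro conjI allI impI)
      show "x \<in> topspace X" by (rule xyX)
      fix T assume "x \<in> T \<and> openin X T"
      then have "x \<in> T \<inter> V" "openin X (T \<inter> V)" using V by auto
      then obtain z where "z \<in> orb" "z \<in> T \<inter> V"
        using xy(1) unfolding Y_def in_closure_of by metis
      then show "\<exists>z. z \<in> (\<lambda>n. act n x0) ` A \<and> z \<in> T" by (auto simp: orb_def A_def)
    qed
    then have "A \<in> g x" by (simp add: g_def)
    then have "A \<in> g y" by (simp add: xy(3))
    then have "y \<in> X closure_of ((\<lambda>n. act n x0) ` A)" by (simp add: g_def)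
    then obtain z where "z \<in> (\<lambda>n. act n x0) ` A" "z \<in> V'"
      using V unfolding in_closure_of by metis
    then show False using V(5) by (auto simp: A_def disjnt_iff)
  qed
  define k where "k = inv_into Y g"
  have kg: "k (g x) = x" if "x \<in> Y" for x using inj that by (simp add: k_def)
  define X' where "X' = pullback_topology (g ` Y) k XY"
  define act' where "act' = (\<lambda>n z. g (act n (k z)))"
  have topX': "topspace X' = g ` Y"
    unfolding X'_def topspace_pullback_topology topXY using kg by auto
  have maps: "homeomorphic_maps XY X' g k"
    unfolding homeomorphic_maps_def
  proof (intro conjI ballI)
    show "continuous_map X' XY k"
      unfolding X'_def using continuous_map_pullback[of XY XY id] by simp
    show "continuous_map XY X' g"
      unfolding X'_def
    proof (rule continuous_map_pullback')
      have "continuous_map XY XY (\<lambda>x. x)" by simp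
      then show "continuous_map XY XY (k \<circ> g)"
        by (rule continuous_map_eq) (simp add: topXY kg)
      show "topspace XY \<subseteq> g -` g ` Y" using topXY by auto
    qed
  qed (use topXY topX' kg in auto)
  have gh: "homeomorphic_map XY X' g" and kh: "homeomorphic_map X' XY k"
    using maps homeomorphic_maps_map homeomorphic_maps_sym by blast+
  have hs: "XY homeomorphic_space X'" using gh homeomorphic_map_imp_homeomorphic_space by blast
  have "compact_Z_system X' act'"
    unfolding compact_Z_system_def
  proof (intro conjI allI ballI)
    show "compact_space X'" "Hausdorff_space X'"
      using XY hs homeomorphic_compact_space homeomorphic_Hausdorff_space by blast+
    show "homeomorphic_map X' X' (act' n)" for n
      using homeomorphic_map_compose[OF homeomorphic_map_compose[OF kh homY[of n]] gh]
      by (simp add: act'_def o_def)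
    show "act' 0 z = z" if "z \<in> topspace X'" for z
      using that Y act0 by (auto simp: topX' act'_def kg subset_iff)
    show "act' (m + n) z = act' m (act' n z)" if "z \<in> topspace X'" for m n z
    proof -
      obtain y where y: "y \<in> Y" "z = g y" using \<open>z \<in> topspace X'\<close> unfolding topX' by (metis imageE)
      have n: "act n y \<in> Y" using actY[of n] y(1) by blast
      have "y \<in> topspace X" using y(1) Y(2) by blast
      then show ?thesis using act_add[of y m n] by (simp add: act'_def y(2) kg[OF y(1)] kg[OF n])
    qed
  qed
  moreover have "HNS X' act'"
    by (rule HNS_transfer[OF XY gh _ _ HY])
      (use actY in \<open>simp_all add: topXY act'_def kg image_subset_iff\<close>)
  moreover have "continuous_map X' euclideanreal (F \<circ> k)"
    using kh F unfolding XY_def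
    by (meson continuous_map_compose continuous_map_from_subtopology homeomorphic_imp_continuous_map)
  moreover have "g x0 \<in> topspace X'" using x0Y by (simp add: topX')
  moreover have "f n = (F \<circ> k) (act' n (g x0))" for n
    using actY[of n] x0Y by (simp add: fF act'_def kg image_subset_iff)
  ultimately have "Asplund_via X' act' f" unfolding Asplund_via_def by blast
  then show ?thesis using bdd unfolding Asp_def by blast
qed

end

theory Submission
  imports Defs
begin

text \<open>Two different invariant means suffice, because every point of the segment between them is
  again an invariant mean. Averaging to the right, a cluster point \<open>M\<close> of the Cesaro means over
  \<open>{0..n}\<close> (lemma \<open>ex_right_mean\<close>) depends only on the behaviour of a function at \<open>+\<infinity>\<close>;
  its reflection \<open>N\<close> (lemma \<open>bounded_mean_reflect\<close>) depends only on the behaviour at \<open>-\<infinity>\<close>. The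
  indicator function of the nonnegative integers has \<open>M\<close>-value \<open>1\<close> and \<open>N\<close>-value \<open>0\<close>, and it is an
  Asplund function: it extends continuously to the compactification of \<open>\<int>\<close> by \<open>-\<infinity>\<close> and
  \<open>\<infinity>\<close>, which is hereditarily nonsensitive because each of its nonempty subsets has an isolated
  point (lemmas \<open>HNS_ext_int\<close> and \<open>Asp_half_line\<close>).

  For the restrictions to \<open>Asp\<close> to be linear functionals, \<open>Asp\<close> has to be closed under addition.
  A sum of two Asplund functions is realised on the product of their systems, so the point is that
  products of HNS systems are HNS (lemma \<open>HNS_prod\<close>). This rests on a fragmentation property of
  arbitrary subsets of an HNS system (lemma \<open>HNS_fragmented\<close>) and on the uniformity of a
  compact space being determined by any two continuous maps that jointly separate its points
  (lemma \<open>entourage_of_jointly_injective\<close>).\<close>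

section \<open>Entourages from jointly injective maps\<close>

text \<open>The closed diagonal and a point off it have disjoint neighbourhoods in the regular space
  \<open>X \<times> X\<close>; the one of the diagonal is the entourage. This is the local step of the compactness
  argument that follows.\<close>

lemma entourage_separating_preimage:
  assumes X: "compact_space X" "Hausdorff_space X" and p: "continuous_map T X p"
    and st: "s \<in> topspace T" "t \<in> topspace T" "p s \<noteq> p t"
  shows "\<exists>N E. openin (prod_topology T T) N \<and> (s, t) \<in> N \<and> eventually E (the_uniformity X) \<and>
           (\<forall>(s', t')\<in>N. \<not> E (p s', p t'))"
proof -
  let ?D = "(\<lambda>x. (x, x)) ` topspace X"
  have reg: "regular_space (prod_topology X X)"
    using X by (intro compact_Hausdorff_imp_regular_space)
      (auto simp: compact_space_prod_topology Hausdorff_space_prod_topology)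
  have "p s \<in> topspace X" "p t \<in> topspace X"
    using p st by (auto simp: continuous_map_def)
  then have "compactin (prod_topology X X) {(p s, p t)}" by simp
  moreover have "closedin (prod_topology X X) ?D"
    using X(2) by (simp add: Hausdorff_space_closedin_diagonal)
  moreover have "disjnt {(p s, p t)} ?D" using st(3) by auto
  ultimately obtain M W where MW: "openin (prod_topology X X) M" "openin (prod_topology X X) W"
    "(p s, p t) \<in> M" "?D \<subseteq> W" "disjnt M W"
    using regular_space_compact_closed_sets[THEN iffD1, OF reg, rule_format,
        of "{(p s, p t)}" ?D] by auto
  let ?N = "{z \<in> topspace (prod_topology T T). (p (fst z), p (snd z)) \<in> M}"
  have "continuous_map (prod_topology T T) (prod_topology X X) (\<lambda>z. (p (fst z), p (snd z)))"
    using p by (intro continuous_map_pairedI)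
      (auto intro: continuous_map_compose[OF continuous_map_fst, unfolded o_def]
        continuous_map_compose[OF continuous_map_snd, unfolded o_def])
  then have "openin (prod_topology T T) ?N"
    using MW(1) by (rule openin_continuous_map_preimage)
  moreover have "eventually (\<lambda>z. z \<in> W) (the_uniformity X)"
    unfolding eventually_the_uniformity[OF X] diagonal_nbhd_def using MW by blast
  ultimately show ?thesis
    using MW(3,5) st(1,2) by (intro exI[of _ ?N] exI[of _ "\<lambda>z. z \<in> W"]) (auto simp: disjnt_iff)
qed

text \<open>The uniformity of a compact space \<open>T\<close> is the initial one for any pair of continuous maps
  that together separate points: the complement in \<open>T \<times> T\<close> of an open neighbourhood \<open>W\<close> of
  the diagonal is compact, and each of its points is excluded by a pulled back entourage, so finitely many pulled
  back entourages exclude everything outside \<open>W\<close>. What matters later is that \<open>D\<close> and \<open>E\<close> do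
  not depend on the points, since smallness has to be checked along whole orbits.\<close>

lemma entourage_of_jointly_injective:
  assumes X: "compact_space X" "Hausdorff_space X" and Y: "compact_space Y" "Hausdorff_space Y"
    and T: "compact_space T" "Hausdorff_space T"
    and p: "continuous_map T X p" and q: "continuous_map T Y q"
    and inj: "\<And>s t. \<lbrakk>s \<in> topspace T; t \<in> topspace T; p s = p t; q s = q t\<rbrakk> \<Longrightarrow> s = t"
    and P: "eventually P (the_uniformity T)"
  obtains D E where "eventually D (the_uniformity X)" "eventually E (the_uniformity Y)"
    "\<And>s t. \<lbrakk>s \<in> topspace T; t \<in> topspace T; D (p s, p t); E (q s, q t)\<rbrakk> \<Longrightarrow> P (s, t)"
proof -
  obtain W where W: "openin (prod_topology T T) W" "\<And>t. t \<in> topspace T \<Longrightarrow> (t, t) \<in> W"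
    "\<And>z. z \<in> W \<Longrightarrow> P z"
    using P unfolding eventually_the_uniformity[OF T] diagonal_nbhd_def by blast
  define K where "K = topspace (prod_topology T T) - W"
  have K: "compactin (prod_topology T T) K"
    unfolding K_def using T(1) W(1)
    by (intro closedin_compact_space closedin_diff closedin_topspace)
      (simp_all add: compact_space_prod_topology)
  define sep where "sep k N D E \<longleftrightarrow> openin (prod_topology T T) N \<and> k \<in> N \<and>
      eventually D (the_uniformity X) \<and> eventually E (the_uniformity Y) \<and>
      (\<forall>(s, t)\<in>N. \<not> (D (p s, p t) \<and> E (q s, q t)))" for k N D E
  have "\<forall>k\<in>K. \<exists>N D E. sep k N D E"
  proof
    fix k assume k: "k \<in> K"
    obtain s t where st: "k = (s, t)" by force
    have sT: "s \<in> topspace T" "t \<in> topspace T" "s \<noteq> t" using k W(2) by (auto simp: K_def st)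
    then consider "p s \<noteq> p t" | "q s \<noteq> q t" using inj by blast
    then show "\<exists>N D E. sep k N D E"
    proof cases
      case 1
      obtain N D where "openin (prod_topology T T) N" "k \<in> N" "eventually D (the_uniformity X)"
        "\<forall>(s, t)\<in>N. \<not> D (p s, p t)"
        using entourage_separating_preimage[OF X p sT(1,2) 1] st by blast
      then show ?thesis by (intro exI[of _ N] exI[of _ D] exI[of _ "\<lambda>_. True"]) (auto simp: sep_def)
    next
      case 2
      obtain N E where "openin (prod_topology T T) N" "k \<in> N" "eventually E (the_uniformity Y)"
        "\<forall>(s, t)\<in>N. \<not> E (q s, q t)"
        using entourage_separating_preimage[OF Y q sT(1,2) 2] st by blast
      then show ?thesis by (intro exI[of _ N] exI[of _ "\<lambda>_. True"] exI[of _ E]) (auto simp: sep_def)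
    qed
  qed
  then obtain N D E where "\<And>k. k \<in> K \<Longrightarrow> sep k (N k) (D k) (E k)" by metis
  then have NDE: "\<And>k. k \<in> K \<Longrightarrow> openin (prod_topology T T) (N k) \<and> k \<in> N k \<and>
      eventually (D k) (the_uniformity X) \<and> eventually (E k) (the_uniformity Y) \<and>
      (\<forall>(s, t)\<in>N k. \<not> (D k (p s, p t) \<and> E k (q s, q t)))"
    by (simp add: sep_def)
  obtain J where J: "finite J" "J \<subseteq> K" "K \<subseteq> \<Union> (N ` J)"
  proof -
    have "\<exists>\<F>. finite \<F> \<and> \<F> \<subseteq> N ` K \<and> K \<subseteq> \<Union> \<F>"
      using NDE by (intro compactinD[OF K]) auto
    then show thesis using that by (metis finite_subset_image)
  qed
  show thesis
  proof
    show "eventually (\<lambda>z. \<forall>k\<in>J. D k z) (the_uniformity X)"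
      "eventually (\<lambda>z. \<forall>k\<in>J. E k z) (the_uniformity Y)"
      using J NDE by (auto intro!: eventually_ball_finite)
    fix s t
    assume st: "s \<in> topspace T" "t \<in> topspace T" "\<forall>k\<in>J. D k (p s, p t)" "\<forall>k\<in>J. E k (q s, q t)"
    have "(s, t) \<notin> K"
    proof
      assume "(s, t) \<in> K"
      then obtain k where "k \<in> J" "(s, t) \<in> N k" using J(3) by blast
      then show False using NDE[of k] J(2) st by blast
    qed
    then show "P (s, t)" using st W(3) by (auto simp: K_def)
  qed
qed

section \<open>Products of hereditarily nonsensitive systems\<close>

lemma compact_Z_systemD:
  assumes "compact_Z_system X act"
  shows "compact_space X" "Hausdorff_space X" "continuous_map X X (act n)"
    "x \<in> topspace X \<Longrightarrow> act n x \<in> topspace X"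
    "x \<in> topspace X \<Longrightarrow> act 0 x = x"
    "x \<in> topspace X \<Longrightarrow> act (m + n) x = act m (act n x)"
proof -
  show c: "continuous_map X X (act n)"
    using assms homeomorphic_imp_continuous_map unfolding compact_Z_system_def by blast
  show "act n x \<in> topspace X" if "x \<in> topspace X"
    using c that by (auto simp: continuous_map_def)
qed (use assms in \<open>auto simp: compact_Z_system_def\<close>)

lemma compact_Z_systemI:
  assumes "compact_space X" "Hausdorff_space X" "\<And>n. continuous_map X X (act n)"
    "\<And>x. x \<in> topspace X \<Longrightarrow> act 0 x = x"
    "\<And>m n x. x \<in> topspace X \<Longrightarrow> act (m + n) x = act m (act n x)"
  shows "compact_Z_system X act"
proof -
  have "homeomorphic_maps X X (act n) (act (- n))" for n
    unfolding homeomorphic_maps_def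
    using assms(3) assms(4) assms(5)[of _ n "- n"] assms(5)[of _ "- n" n] by auto
  then show ?thesis
    unfolding compact_Z_system_def using assms homeomorphic_maps_imp_map by blast
qed

text \<open>The HNS property only speaks of closed invariant sets, whereas the product argument needs
  small relatively open pieces of arbitrary subsets \<open>A\<close>. Nonsensitivity of the closed orbit hull of
  \<open>A\<close> gives a small open set \<open>U\<close> there. By density, \<open>U\<close> meets some translate \<open>act k ` A\<close>, and being
  small along all of \<open>\<int>\<close> is invariant under translation, so \<open>U\<close> can be moved back by \<open>k\<close> to
  meet \<open>A\<close> itself.\<close>

lemma HNS_fragmented:
  assumes sys: "compact_Z_system X act" and H: "HNS X act"
    and A: "A \<subseteq> topspace X" "A \<noteq> {}" and E: "eventually E (the_uniformity X)"
  obtains V where "openin X V" "A \<inter> V \<noteq> {}"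
    "\<And>n x y. \<lbrakk>x \<in> A \<inter> V; y \<in> A \<inter> V\<rbrakk> \<Longrightarrow> E (act n x, act n y)"
proof -
  note X = compact_Z_systemD[OF sys]
  define S where "S = (\<Union>n. act n ` A)"
  define K where "K = X closure_of S"
  have SX: "S \<subseteq> topspace X" using A(1) X(4) by (auto simp: S_def)
  have SK: "S \<subseteq> K" unfolding K_def using SX by (rule closure_of_subset)
  have KX: "closedin X K" by (simp add: K_def)
  have "S \<noteq> {}" using A(2) by (auto simp: S_def)
  moreover have "act n ` K \<subseteq> K" for n
  proof -
    have "act n ` K \<subseteq> X closure_of (act n ` S)"
      unfolding K_def by (rule continuous_map_image_closure_subset[OF X(3)])
    moreover have "act n ` S \<subseteq> S"
    proof clarify
      fix x assume "x \<in> S"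
      then obtain m a where a: "a \<in> A" "x = act m a" by (auto simp: S_def)
      then have "act n x = act (n + m) a" using X(6) A(1) by auto
      then show "act n x \<in> S" using a by (auto simp: S_def)
    qed
    ultimately show ?thesis unfolding K_def by (meson closure_of_mono order_trans)
  qed
  ultimately have ns: "nonsensitive (subtopology X K) act"
    using H KX SK unfolding HNS_def by blast
  have cK: "compact_space (subtopology X K)" "Hausdorff_space (subtopology X K)"
    using X(1,2) KX closedin_compact_space compact_space_subtopology Hausdorff_space_subtopology
    by blast+
  have "eventually (\<lambda>p. p \<in> {p. E p}) (the_uniformity (subtopology X K))"
  proof -
    obtain W where W: "openin (prod_topology X X) W" "\<forall>x\<in>topspace X. (x, x) \<in> W" "\<forall>p\<in>W. E p"
      using E unfolding eventually_the_uniformity[OF X(1,2)] diagonal_nbhd_def by blast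
    have "openin (prod_topology (subtopology X K) (subtopology X K)) (W \<inter> K \<times> K)"
      unfolding subtopology_Times[symmetric] openin_subtopology using W(1) by blast
    then show ?thesis
      unfolding eventually_the_uniformity[OF cK] diagonal_nbhd_def using W
      by (intro exI[of _ "W \<inter> K \<times> K"]) auto
  qed
  then obtain O' where O': "openin (subtopology X K) O'" "O' \<noteq> {}"
    "\<And>n. (act n ` O') \<times> (act n ` O') \<subseteq> {p. E p}"
    using ns unfolding nonsensitive_def by blast
  then obtain U where U: "openin X U" "O' = U \<inter> K" by (auto simp: openin_subtopology)
  then obtain s where "s \<in> S" "s \<in> U"
    using O'(2) openin_Int_closure_of_eq_empty[OF U(1), of S] by (auto simp: K_def)
  then obtain k a where a: "a \<in> A" "act k a \<in> U" by (auto simp: S_def)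
  show thesis
  proof
    let ?V = "{x \<in> topspace X. act k x \<in> U}"
    show "openin X ?V" using X(3) U(1) by (rule openin_continuous_map_preimage)
    show "A \<inter> ?V \<noteq> {}" using a A(1) by blast
    fix n x y assume xy: "x \<in> A \<inter> ?V" "y \<in> A \<inter> ?V"
    then have "act k x \<in> O'" "act k y \<in> O'" using U(2) SK by (auto simp: S_def)
    then have "E (act (n - k) (act k x), act (n - k) (act k y))" using O'(3)[of "n - k"] by blast
    then show "E (act n x, act n y)" using X(6)[of _ "n - k" k] xy by simp
  qed
qed

text \<open>Fragmentation is used twice: first on the image of \<open>T\<close> in \<open>X\<close>, then on the image in \<open>Y\<close> of the
  part of \<open>T\<close> lying over the small piece just found. That part is not invariant, which is why
  nonsensitivity of closed invariant subsets alone would not be enough here.\<close>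

lemma nonsensitive_jointly_injective:
  assumes X: "compact_Z_system X a" "HNS X a" and Y: "compact_Z_system Y b" "HNS Y b"
    and T: "compact_space T" "Hausdorff_space T" "topspace T \<noteq> {}"
    and c: "\<And>n t. t \<in> topspace T \<Longrightarrow> c n t \<in> topspace T"
    and p: "continuous_map T X p" "\<And>n t. t \<in> topspace T \<Longrightarrow> p (c n t) = a n (p t)"
    and q: "continuous_map T Y q" "\<And>n t. t \<in> topspace T \<Longrightarrow> q (c n t) = b n (q t)"
    and inj: "\<And>s t. \<lbrakk>s \<in> topspace T; t \<in> topspace T; p s = p t; q s = q t\<rbrakk> \<Longrightarrow> s = t"
  shows "nonsensitive T c"
  unfolding nonsensitive_def
proof (intro allI impI)
  fix P assume P: "eventually (\<lambda>z. z \<in> P) (the_uniformity T)"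
  obtain D E where DE: "eventually D (the_uniformity X)" "eventually E (the_uniformity Y)"
    and DEP: "\<And>s t. \<lbrakk>s \<in> topspace T; t \<in> topspace T; D (p s, p t); E (q s, q t)\<rbrakk> \<Longrightarrow> (s, t) \<in> P"
    using entourage_of_jointly_injective[OF compact_Z_systemD(1,2)[OF X(1)]
        compact_Z_systemD(1,2)[OF Y(1)] T(1,2) p(1) q(1) inj P] by blast
  have "p ` topspace T \<subseteq> topspace X" "p ` topspace T \<noteq> {}"
    using p(1) T(3) by (auto simp: continuous_map_def)
  then obtain U where U: "openin X U" "p ` topspace T \<inter> U \<noteq> {}"
    "\<And>n x y. \<lbrakk>x \<in> p ` topspace T \<inter> U; y \<in> p ` topspace T \<inter> U\<rbrakk> \<Longrightarrow> D (a n x, a n y)"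
    using HNS_fragmented[OF X _ _ DE(1)] by blast
  define B where "B = q ` {t \<in> topspace T. p t \<in> U}"
  have "B \<subseteq> topspace Y" "B \<noteq> {}"
    using q(1) U(2) by (auto simp: continuous_map_def B_def)
  then obtain V where V: "openin Y V" "B \<inter> V \<noteq> {}"
    "\<And>n x y. \<lbrakk>x \<in> B \<inter> V; y \<in> B \<inter> V\<rbrakk> \<Longrightarrow> E (b n x, b n y)"
    using HNS_fragmented[OF Y _ _ DE(2)] by blast
  let ?O = "{t \<in> topspace T. p t \<in> U} \<inter> {t \<in> topspace T. q t \<in> V}"
  show "\<exists>V. openin T V \<and> V \<noteq> {} \<and> (\<forall>n. c n ` V \<times> c n ` V \<subseteq> P)"
  proof (intro exI conjI allI)
    show "openin T ?O"
      by (intro openin_Int openin_continuous_map_preimage[OF p(1) U(1)]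
          openin_continuous_map_preimage[OF q(1) V(1)])
    show "?O \<noteq> {}" using V(2) by (auto simp: B_def)
    show "c n ` ?O \<times> c n ` ?O \<subseteq> P" for n
    proof clarify
      fix s t
      assume s: "s \<in> topspace T" "p s \<in> U" "q s \<in> V" and t: "t \<in> topspace T" "p t \<in> U" "q t \<in> V"
      have "D (a n (p s), a n (p t))" using U(3) s t by blast
      moreover have "E (b n (q s), b n (q t))" using V(3) s t unfolding B_def by blast
      ultimately show "(c n s, c n t) \<in> P" using DEP c p(2) q(2) s(1) t(1) by simp
    qed
  qed
qed

lemma HNS_prod:
  assumes X: "compact_Z_system X a" "HNS X a" and Y: "compact_Z_system Y b" "HNS Y b"
  shows "compact_Z_system (prod_topology X Y) (\<lambda>n (x, y). (a n x, b n y))" (is "?sys")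
    and "HNS (prod_topology X Y) (\<lambda>n (x, y). (a n x, b n y))" (is "?HNS")
proof -
  let ?c = "\<lambda>n (x, y). (a n x, b n y)"
  note X' = compact_Z_systemD[OF X(1)] and Y' = compact_Z_systemD[OF Y(1)]
  have P: "compact_space (prod_topology X Y)" "Hausdorff_space (prod_topology X Y)"
    using X' Y' by (auto simp: compact_space_prod_topology Hausdorff_space_prod_topology)
  show ?sys
    by (rule compact_Z_systemI[OF P]) (use X' Y' in \<open>auto simp: continuous_map_prod_top\<close>)
  show ?HNS
    unfolding HNS_def
  proof (intro allI impI)
    fix Z assume Z: "closedin (prod_topology X Y) Z \<and> Z \<noteq> {} \<and> (\<forall>n. ?c n ` Z \<subseteq> Z)"
    then have ZT: "topspace (subtopology (prod_topology X Y) Z) = Z"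
      by (intro topspace_subtopology_subset closedin_subset) simp
    show "nonsensitive (subtopology (prod_topology X Y) Z) ?c"
    proof (rule nonsensitive_jointly_injective[OF X Y, where p = fst and q = snd])
      show "compact_space (subtopology (prod_topology X Y) Z)"
        using P Z closedin_compact_space compact_space_subtopology by blast
      show "Hausdorff_space (subtopology (prod_topology X Y) Z)"
        using P Hausdorff_space_subtopology by blast
      show "?c n t \<in> topspace (subtopology (prod_topology X Y) Z)"
        if "t \<in> topspace (subtopology (prod_topology X Y) Z)" for n t
        using that Z unfolding ZT by blast
    qed (use Z ZT in \<open>auto intro: continuous_map_from_subtopology continuous_map_fst
        continuous_map_snd\<close>)
  qed
qed

section \<open>\<open>Asp\<close> is a translation invariant linear space\<close>

lemma Asp_add:
  assumes "f \<in> Asp" "g \<in> Asp"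
  shows "(\<lambda>k. f k + g k) \<in> Asp"
proof -
  obtain X :: "int set set topology" and a F x
    where X: "compact_Z_system X a" "HNS X a"
    and F: "continuous_map X euclideanreal F" "x \<in> topspace X" "\<And>n. f n = F (a n x)"
    using assms(1) unfolding Asp_def Asplund_via_def by blast
  obtain Y :: "int set set topology" and b G y
    where Y: "compact_Z_system Y b" "HNS Y b"
    and G: "continuous_map Y euclideanreal G" "y \<in> topspace Y" "\<And>n. g n = G (b n y)"
    using assms(2) unfolding Asp_def Asplund_via_def by blast
  have "continuous_map (prod_topology X Y) euclideanreal (\<lambda>z. F (fst z) + G (snd z))"
    using continuous_map_compose[OF continuous_map_fst F(1)]
      continuous_map_compose[OF continuous_map_snd G(1)]
    by (intro continuous_map_add) (auto simp: o_def)
  then have "Asplund_via (prod_topology X Y) (\<lambda>n (x, y). (a n x, b n y)) (\<lambda>k. f k + g k)"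
    unfolding Asplund_via_def using HNS_prod[OF X Y] F(2,3) G(2,3)
    by (intro conjI exI[of _ "\<lambda>z. F (fst z) + G (snd z)"] exI[of _ "(x, y)"]) auto
  then show ?thesis by (rule Asplund_via_imp_Asp)
qed

lemma Asp_scale:
  assumes "f \<in> Asp"
  shows "(\<lambda>k. r * f k) \<in> Asp"
proof -
  obtain X :: "int set set topology" and a F x
    where X: "compact_Z_system X a" "HNS X a"
    and F: "continuous_map X euclideanreal F" "x \<in> topspace X" "\<And>n. f n = F (a n x)"
    using assms unfolding Asp_def Asplund_via_def by blast
  have "continuous_map X euclideanreal (\<lambda>z. r * F z)"
    using F(1) by (intro continuous_map_real_mult) auto
  then have "Asplund_via X a (\<lambda>k. r * f k)"
    unfolding Asplund_via_def using X F(2,3)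
    by (intro conjI exI[of _ "\<lambda>z. r * F z"] exI[of _ x]) auto
  then show ?thesis by (rule Asplund_via_imp_Asp)
qed

lemma Asp_translate:
  assumes "f \<in> Asp"
  shows "(\<lambda>k. f (n + k)) \<in> Asp"
proof -
  obtain X :: "int set set topology" and a F x
    where X: "compact_Z_system X a" "HNS X a"
    and F: "continuous_map X euclideanreal F" "x \<in> topspace X" "\<And>n. f n = F (a n x)"
    using assms unfolding Asp_def Asplund_via_def by blast
  have "f (n + k) = F (a k (a n x))" for k
    using compact_Z_systemD(6)[OF X(1) F(2), of k n] F(3) by (simp add: add.commute)
  then have "Asplund_via X a (\<lambda>k. f (n + k))"
    unfolding Asplund_via_def using X F(1) compact_Z_systemD(4)[OF X(1) F(2)]
    by (intro conjI exI[of _ F] exI[of _ "a n x"]) auto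
  then show ?thesis by (rule Asplund_via_imp_Asp)
qed

section \<open>The two-point compactification of the integers\<close>

text \<open>The compactification of \<open>\<int>\<close> by two fixed points. Realising it inside the extended reals
  provides the topology and the continuity of translations.\<close>

definition ext_int :: "ereal set" where
  "ext_int = insert \<infinity> (insert (- \<infinity>) (range (\<lambda>k::int. ereal (of_int k))))"

lemma ext_int_gap: "x \<in> ext_int \<longleftrightarrow> \<not> (\<exists>k::int. ereal (of_int k) < x \<and> x < ereal (of_int k + 1))"
proof (cases x)
  case (real r)
  have "(\<exists>k::int. r = of_int k) \<longleftrightarrow> \<not> (\<exists>k::int. of_int k < r \<and> r < of_int k + 1)"
  proof
    show "\<exists>k::int. r = of_int k \<Longrightarrow> \<not> (\<exists>k::int. of_int k < r \<and> r < of_int k + 1)" by auto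
    assume "\<not> (\<exists>k::int. of_int k < r \<and> r < of_int k + 1)"
    then have "\<not> (of_int \<lfloor>r\<rfloor> < r \<and> r < of_int \<lfloor>r\<rfloor> + 1)" by blast
    then have "r = of_int \<lfloor>r\<rfloor>" using floor_correct[of r] by linarith
    then show "\<exists>k::int. r = of_int k" by blast
  qed
  then show ?thesis using real by (auto simp: ext_int_def)
qed (auto simp: ext_int_def)

lemma compact_ext_int: "compact ext_int"
proof -
  have "- ext_int = (\<Union>k::int. {ereal (of_int k)<..<ereal (of_int k + 1)})"
    using ext_int_gap by auto
  then have "closed ext_int" unfolding closed_def by auto
  then show ?thesis by (simp add: compact_eq_closed)
qed

text \<open>\<open>ext_int\<close> is scattered: integers are isolated in it, and a set without integers is discrete.\<close>

lemma ext_int_isolated_point: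
  assumes "Y \<subseteq> ext_int" "Y \<noteq> {}"
  obtains y where "openin (top_of_set Y) {y}"
proof -
  have sing: "openin (top_of_set Y) {y}"
    if "open U" "y \<in> Y" "y \<in> U" "\<And>x. \<lbrakk>x \<in> Y; x \<in> U\<rbrakk> \<Longrightarrow> x = y" for U y
  proof -
    have "Y \<inter> U = {y}" using that(2-4) by blast
    then show ?thesis using openin_open_Int[OF that(1), of Y] by simp
  qed
  consider k :: int where "ereal (of_int k) \<in> Y" | "\<infinity> \<in> Y" "Y \<subseteq> {\<infinity>, - \<infinity>}"
    | "Y = {- \<infinity>}"
    using assms unfolding ext_int_def by blast
  then show thesis
  proof cases
    case 1
    show thesis
    proof (rule that[OF sing])
      show "open {ereal (of_int k - 1)<..<ereal (of_int k + 1)}" by (rule open_greaterThanLessThan)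
      show "ereal (of_int k) \<in> Y" by (rule 1)
      show "ereal (of_int k) \<in> {ereal (of_int k - 1)<..<ereal (of_int k + 1)}" by simp
      fix x assume "x \<in> Y" and x: "x \<in> {ereal (of_int k - 1)<..<ereal (of_int k + 1)}"
      then have "x \<in> ext_int" using assms(1) by blast
      then obtain j :: int where "x = ereal (of_int j)" using x by (auto simp: ext_int_def)
      moreover from this have "k = j" using x by simp
      ultimately show "x = ereal (of_int k)" by simp
    qed
  next
    case 2
    then show thesis by (intro that[OF sing[of "{0<..}" \<infinity>]]) auto
  next
    case 3
    then show thesis by (intro that[OF sing[of UNIV "- \<infinity>"]]) auto
  qed
qed

text \<open>All translates of the open set \<open>{y}\<close> are singletons, hence small for every entourage.\<close>

lemma nonsensitive_isolated_point:
  assumes "compact_space X" "Hausdorff_space X" "openin X {y}"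
    "\<And>n. act n y \<in> topspace X"
  shows "nonsensitive X act"
  unfolding nonsensitive_def eventually_the_uniformity[OF assms(1,2)] diagonal_nbhd_def
  using assms(3,4) by (intro allI impI exI[of _ "{y}"]) auto

abbreviation shift :: "int \<Rightarrow> ereal \<Rightarrow> ereal" where
  "shift n x \<equiv> x + ereal (of_int n)"

lemma shift_ext_int: "x \<in> ext_int \<Longrightarrow> shift n x \<in> ext_int"
  by (auto simp: ext_int_def image_iff simp flip: of_int_add)

lemma Hausdorff_space_euclidean_t2: "Hausdorff_space (euclidean :: 'a::t2_space topology)"
  unfolding Hausdorff_space_def disjnt_def by (metis hausdorff open_openin)

lemma compact_Z_system_ext_int: "compact_Z_system (top_of_set ext_int) shift"
proof (rule compact_Z_systemI)
  show "compact_space (top_of_set ext_int)"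
    using compact_ext_int by (simp add: compact_space_subtopology)
  show "Hausdorff_space (top_of_set ext_int)" by (intro Hausdorff_space_subtopology Hausdorff_space_euclidean_t2)
  show "continuous_map (top_of_set ext_int) (top_of_set ext_int) (shift n)" for n
    unfolding continuous_map_subtopology_eu
    using shift_ext_int by (auto simp: continuous_on_def)
  show "shift (m + n) x = shift m (shift n x)" for m n x
    by (cases x) auto
qed (simp add: zero_ereal_def[symmetric])

lemma HNS_ext_int: "HNS (top_of_set ext_int) shift"
  unfolding HNS_def
proof (intro allI impI)
  fix Y assume Y: "closedin (top_of_set ext_int) Y \<and> Y \<noteq> {} \<and> (\<forall>n. shift n ` Y \<subseteq> Y)"
  then have sub: "Y \<subseteq> ext_int" using closedin_imp_subset by blast
  then obtain y where y: "openin (top_of_set Y) {y}"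
    using ext_int_isolated_point Y by blast
  have eq: "subtopology (top_of_set ext_int) Y = top_of_set Y"
    using sub by (simp add: subtopology_subtopology Int_absorb1)
  show "nonsensitive (subtopology (top_of_set ext_int) Y) shift"
    unfolding eq
  proof (rule nonsensitive_isolated_point[OF _ _ y])
    have "compact Y"
      using Y compact_ext_int closedin_compact_eq by blast
    then show "compact_space (top_of_set Y)" by (simp add: compact_space_subtopology)
    show "Hausdorff_space (top_of_set Y)" by (intro Hausdorff_space_subtopology Hausdorff_space_euclidean_t2)
    have "y \<in> Y" using openin_subset[OF y] by simp
    then show "shift n y \<in> topspace (top_of_set Y)" for n using Y by auto
  qed
qed

lemma Asp_ext_int:
  assumes "continuous_on ext_int F"
  shows "(\<lambda>k. F (ereal (of_int k))) \<in> Asp"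
proof (rule Asplund_via_imp_Asp)
  show "Asplund_via (top_of_set ext_int) shift (\<lambda>k. F (ereal (of_int k)))"
    unfolding Asplund_via_def using compact_Z_system_ext_int HNS_ext_int assms
    by (intro conjI exI[of _ F] exI[of _ 0]) (auto simp: ext_int_def zero_ereal_def)
qed

lemma Asp_one: "(\<lambda>_. 1) \<in> Asp"
  using Asp_ext_int[of "\<lambda>_. 1"] by simp

lemma Asp_half_line: "(\<lambda>k. if 0 \<le> k then 1 else 0) \<in> Asp"
proof -
  let ?A = "ext_int \<inter> {0..}" and ?B = "ext_int \<inter> {..-1}"
  have un: "ext_int = ?A \<union> ?B"
  proof -
    have "0 \<le> x \<or> x \<le> - 1" if "x \<in> ext_int" for x
      using that by (auto simp: ext_int_def zero_ereal_def one_ereal_def)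
    then show ?thesis by auto
  qed
  have "continuous_on (?A \<union> ?B) (\<lambda>x::ereal. if 0 \<le> x then 1 else 0 :: real)"
  proof (rule continuous_on_cases)
    show "closed ?A" "closed ?B" using compact_ext_int by (auto intro: compact_imp_closed)
    show "\<forall>x. x \<in> ?A \<and> \<not> 0 \<le> x \<or> x \<in> ?B \<and> 0 \<le> x \<longrightarrow> (1::real) = 0"
      using order_trans[of "0::ereal" _ "- 1"] by (auto simp: zero_ereal_def one_ereal_def)
  qed (auto simp: zero_ereal_def one_ereal_def)
  from Asp_ext_int[OF this[folded un]] show ?thesis by simp
qed

section \<open>Invariant means on bounded functions\<close>

definition cesaro :: "nat \<Rightarrow> (int \<Rightarrow> real) \<Rightarrow> real" where
  "cesaro n f = (\<Sum>k\<le>n. f (int k)) / (real n + 1)"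

lemma abs_le_sup_norm:
  assumes "bounded (range f)"
  shows "\<bar>f k\<bar> \<le> sup_norm f"
proof -
  obtain B where "\<And>k. \<bar>f k\<bar> \<le> B" using assms by (auto simp: bounded_iff)
  then show ?thesis unfolding sup_norm_def by (intro cSUP_upper bdd_aboveI[of _ B]) auto
qed

lemma abs_cesaro_le:
  assumes "bounded (range f)"
  shows "\<bar>cesaro n f\<bar> \<le> sup_norm f"
proof -
  have "\<bar>\<Sum>k\<le>n. f (int k)\<bar> \<le> (\<Sum>k\<le>n. \<bar>f (int k)\<bar>)" by (rule sum_abs)
  also have "\<dots> \<le> (\<Sum>k\<le>n. sup_norm f)" by (intro sum_mono abs_le_sup_norm assms)
  finally show ?thesis by (simp add: cesaro_def field_simps)
qed

lemma cesaro_shift_tendsto_0: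
  assumes "bounded (range f)"
  shows "(\<lambda>n. cesaro n (\<lambda>k. f (1 + k)) - cesaro n f) \<longlonglongrightarrow> 0"
proof (rule Lim_null_comparison)
  have "cesaro n (\<lambda>k. f (1 + k)) - cesaro n f = (f (1 + int n) - f 0) / (real n + 1)" for n
  proof -
    have "(\<Sum>k\<le>n. f (1 + int k)) - (\<Sum>k\<le>n. f (int k)) = f (1 + int n) - f 0"
      by (induction n) auto
    then show ?thesis by (simp add: cesaro_def flip: diff_divide_distrib)
  qed
  moreover have "\<bar>f (1 + int n) - f 0\<bar> \<le> 2 * sup_norm f" for n
    using abs_le_sup_norm[OF assms, of "1 + int n"] abs_le_sup_norm[OF assms, of 0] by linarith
  ultimately show "\<forall>\<^sub>F n in sequentially.
      norm (cesaro n (\<lambda>k. f (1 + k)) - cesaro n f) \<le> 2 * sup_norm f / (real n + 1)"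
    by (auto simp: abs_divide intro!: always_eventually divide_right_mono)
  show "(\<lambda>n. 2 * sup_norm f / (real n + 1)) \<longlonglongrightarrow> 0"
    using LIMSEQ_Suc[OF lim_const_over_n[of "2 * sup_norm f"]] by (simp add: add.commute)
qed

text \<open>Means are built on all bounded functions and restricted to \<open>Asp\<close> only at the end.
  Normalisation is kept apart: for the means constructed below it is a special case of their values
  on functions that are constant on a half-line.\<close>

locale bounded_mean =
  fixes M :: "(int \<Rightarrow> real) \<Rightarrow> real"
  assumes add: "\<lbrakk>bounded (range f); bounded (range g)\<rbrakk> \<Longrightarrow> M (\<lambda>k. f k + g k) = M f + M g"
    and scale: "bounded (range f) \<Longrightarrow> M (\<lambda>k. c * f k) = c * M f"
    and abs_le: "bounded (range f) \<Longrightarrow> \<bar>M f\<bar> \<le> sup_norm f"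
    and translate: "bounded (range f) \<Longrightarrow> M (\<lambda>k. f (n + k)) = M f"

lemma bounded_translate: "bounded (range f) \<Longrightarrow> bounded (range (\<lambda>k::int. f (n + k) :: real))"
  by (erule bounded_subset) auto

lemma translate_from_unit:
  fixes M :: "(int \<Rightarrow> real) \<Rightarrow> real"
  assumes M: "\<And>f. bounded (range f) \<Longrightarrow> M (\<lambda>k. f (1 + k)) = M f" and f: "bounded (range f)"
  shows "M (\<lambda>k. f (n + k)) = M f"
proof (induction n rule: int_induct[where k = 0])
  case (step1 i)
  then show ?case using M[OF bounded_translate[OF f, of i]] by (simp add: algebra_simps)
next
  case (step2 i)
  then show ?case using M[OF bounded_translate[OF f, of "i - 1"]] by (simp add: algebra_simps)
qed simp

text \<open>A cluster point of the Cesaro means in the product of the intervals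
  \<open>{- sup_norm f..sup_norm f}\<close>, which is compact by Tychonoff's theorem. Linear identities hold for
  every Cesaro mean and invariance holds asymptotically, so both pass to the cluster point. As only
  values at nonnegative integers enter, so does the value on functions constant there.\<close>

lemma ex_right_mean:
  obtains M where "bounded_mean M" "\<And>f c. (\<And>k. 0 \<le> k \<Longrightarrow> f k = c) \<Longrightarrow> bounded (range f) \<Longrightarrow> M f = c"
proof -
  \<comment> \<open>On unbounded functions everything is \<open>0\<close>, so that the product can run over all functions.\<close>
  define \<phi> where "\<phi> n f = (if bounded (range f) then cesaro n f else 0)" for n f
  define r where "r f = (if bounded (range f) then sup_norm f else 0)" for f
  have \<phi>: "\<phi> n f = cesaro n f" if "bounded (range f)" for n f using that by (simp add: \<phi>_def)
  have "compactin (product_topology (\<lambda>_. euclideanreal) UNIV) (PiE UNIV (\<lambda>f. {- r f..r f}))"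
    by (subst compactin_PiE) auto
  then have "compact (PiE UNIV (\<lambda>f. {- r f..r f}))"
    by (simp add: euclidean_product_topology)
  moreover have "\<phi> n \<in> PiE UNIV (\<lambda>f. {- r f..r f})" for n
    using abs_cesaro_le by (auto simp: \<phi>_def r_def abs_le_iff minus_le_iff)
  ultimately obtain M where M: "M \<in> PiE UNIV (\<lambda>f. {- r f..r f})"
    and nbot: "inf (nhds M) (filtermap \<phi> sequentially) \<noteq> bot"
    unfolding compact_filter
    by (metis (no_types, lifting) eventually_filtermap eventually_sequentiallyI filtermap_bot_iff
        sequentially_bot)
  \<comment> \<open>A filter of functionals finer than the tail filter of the Cesaro means and converging
    pointwise to \<open>M\<close>; every limit law for \<open>M\<close> is obtained along it.\<close>
  define G where "G = inf (nhds M) (filtermap \<phi> sequentially)"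
  have G: "G \<noteq> bot" using nbot by (simp add: G_def)
  have ev: "eventually P G" if "\<And>n. P (\<phi> n)" for P
    unfolding G_def using that by (intro filter_leD[OF inf_le2]) (auto simp: eventually_filtermap)
  have lim: "((\<lambda>\<psi>. \<psi> f) \<longlongrightarrow> M f) G" for f
  proof -
    have "continuous_on UNIV (\<lambda>\<psi>::(int \<Rightarrow> real) \<Rightarrow> real. \<psi> f)" by simp
    then have "((\<lambda>\<psi>. \<psi> f) \<longlongrightarrow> M f) (nhds M)"
      using tendsto_at_iff_tendsto_nhds[of "\<lambda>\<psi>. \<psi> f" M] by (auto simp: continuous_on_def)
    then show ?thesis unfolding G_def by (rule tendsto_mono[OF inf_le1])
  qed
  have eq: "M f = L" if "\<And>n. \<phi> n f = \<phi>' (\<phi> n)" "(\<phi>' \<longlongrightarrow> L) G" for f \<phi>' L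
    by (rule tendsto_unique[OF G lim], rule Lim_transform_eventually[OF that(2)])
      (rule ev, simp add: that(1))
  show thesis
  proof (rule that[of M])
    show "bounded_mean M"
    proof
      fix f g :: "int \<Rightarrow> real" and c n
      assume f: "bounded (range f)"
      show "M (\<lambda>k. f k + g k) = M f + M g" if g: "bounded (range g)"
        by (rule eq[OF _ tendsto_add[OF lim lim]])
          (simp add: \<phi> f g bounded_plus_comp cesaro_def sum.distrib add_divide_distrib)
      show "M (\<lambda>k. c * f k) = c * M f"
      proof (rule eq[OF _ tendsto_mult_left[OF lim]])
        have "bounded (range (\<lambda>k. c * f k))"
          using bounded_scaling[OF f, of c] by (simp add: image_image)
        then show "\<phi> n (\<lambda>k. c * f k) = c * \<phi> n f" for n
          using f by (simp add: \<phi> cesaro_def sum_distrib_left)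
      qed
      show "\<bar>M f\<bar> \<le> sup_norm f"
        using M f by (auto simp: r_def PiE_iff abs_le_iff minus_le_iff split: if_splits)
      show "M (\<lambda>k. f (n + k)) = M f"
      proof (rule translate_from_unit[OF _ f])
        fix f :: "int \<Rightarrow> real"
        assume f: "bounded (range f)"
        have "((\<lambda>\<psi>. \<psi> (\<lambda>k. f (1 + k)) - \<psi> f) \<longlongrightarrow> 0) (filtermap \<phi> sequentially)"
          unfolding filterlim_filtermap
          using cesaro_shift_tendsto_0[OF f] by (simp add: \<phi> f bounded_translate)
        then have "((\<lambda>\<psi>. \<psi> (\<lambda>k. f (1 + k)) - \<psi> f) \<longlongrightarrow> 0) G"
          unfolding G_def by (rule tendsto_mono[OF inf_le2])
        then have "M (\<lambda>k. f (1 + k)) - M f = 0"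
          by (rule tendsto_unique[OF G tendsto_diff[OF lim lim]])
        then show "M (\<lambda>k. f (1 + k)) = M f" by simp
      qed
    qed
    fix f :: "int \<Rightarrow> real" and c
    assume "\<And>k. 0 \<le> k \<Longrightarrow> f k = c" "bounded (range f)"
    then show "M f = c"
      by (intro eq[OF _ tendsto_const]) (simp add: \<phi> cesaro_def field_simps)
  qed
qed

text \<open>The map \<open>k \<mapsto> - 1 - k\<close>, rather than \<open>k \<mapsto> - k\<close>, exchanges the nonnegative and the negative
  integers exactly; a mean living on the former becomes one living on the latter.\<close>

lemma bounded_mean_reflect:
  assumes "bounded_mean M"
  shows "bounded_mean (\<lambda>f. M (\<lambda>k. f (- 1 - k)))"
proof -
  interpret bounded_mean M by fact
  have b: "bounded (range (\<lambda>k. f (- 1 - k)))" if "bounded (range f)" for f :: "int \<Rightarrow> real"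
    using that by (rule bounded_subset) auto
  show ?thesis
  proof
    fix f :: "int \<Rightarrow> real" and n :: int
    assume f: "bounded (range f)"
    have "sup_norm (\<lambda>k. f (- 1 - k)) = sup_norm f"
    proof -
      have "range (\<lambda>k. \<bar>f (- 1 - k)\<bar>) = (\<lambda>k. \<bar>f k\<bar>) ` range (\<lambda>k::int. - 1 - k)"
        by (simp only: image_image)
      also have "range (\<lambda>k::int. - 1 - k) = UNIV" by (rule surjI[of _ "\<lambda>k. - 1 - k"]) simp
      finally show ?thesis by (simp add: sup_norm_def)
    qed
    then show "\<bar>M (\<lambda>k. f (- 1 - k))\<bar> \<le> sup_norm f" using abs_le[OF b[OF f]] by simp
    have "(\<lambda>k. f (n + (- 1 - k))) = (\<lambda>k. f (- 1 - (- n + k)))" by (simp add: algebra_simps)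
    then show "M (\<lambda>k. f (n + (- 1 - k))) = M (\<lambda>k. f (- 1 - k))"
      using translate[OF b[OF f], of "- n"] by simp
  qed (simp_all add: add scale b)
qed

lemma bounded_mean_convex:
  assumes "bounded_mean M" "bounded_mean N" and t: "0 \<le> t" "t \<le> 1"
  shows "bounded_mean (\<lambda>f. t * M f + (1 - t) * N f)"
proof -
  interpret M: bounded_mean M by fact
  interpret N: bounded_mean N by fact
  show ?thesis
  proof
    fix f :: "int \<Rightarrow> real"
    assume f: "bounded (range f)"
    have "\<bar>t * M f + (1 - t) * N f\<bar> \<le> t * \<bar>M f\<bar> + (1 - t) * \<bar>N f\<bar>"
      using t abs_triangle_ineq[of "t * M f" "(1 - t) * N f"] by (simp add: abs_mult)
    also have "\<dots> \<le> sup_norm f" using M.abs_le[OF f] N.abs_le[OF f] t by (intro convex_bound_le) auto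
    finally show "\<bar>t * M f + (1 - t) * N f\<bar> \<le> sup_norm f" .
  qed (simp_all add: M.add N.add M.scale N.scale M.translate N.translate algebra_simps)
qed

lemma bounded_mean_restrict:
  assumes "bounded_mean M" and one: "M (\<lambda>_. 1) = 1"
    and A: "\<And>f. f \<in> A \<Longrightarrow> bounded (range f)" "(\<lambda>_. 1) \<in> A"
    "\<And>f g. \<lbrakk>f \<in> A; g \<in> A\<rbrakk> \<Longrightarrow> (\<lambda>k. f k + g k) \<in> A" "\<And>f c. f \<in> A \<Longrightarrow> (\<lambda>k. c * f k) \<in> A"
    "\<And>f n. f \<in> A \<Longrightarrow> (\<lambda>k. f (n + k)) \<in> A"
  shows "invariant_mean A (restrict M A)"
proof -
  interpret bounded_mean M by fact
  have "functional_norm A (restrict M A) = 1"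
    unfolding functional_norm_def
  proof (rule antisym)
    show "(SUP f\<in>{f \<in> A. sup_norm f \<le> 1}. ereal \<bar>restrict M A f\<bar>) \<le> 1"
      using abs_le A(1) by (fastforce intro!: SUP_least simp: one_ereal_def)
    have "(\<lambda>_. 1) \<in> {f \<in> A. sup_norm f \<le> 1}" using A(2) by (simp add: sup_norm_def)
    moreover have "1 \<le> ereal \<bar>restrict M A (\<lambda>_. 1)\<bar>" using A(2) one by (simp add: one_ereal_def)
    ultimately show "1 \<le> (SUP f\<in>{f \<in> A. sup_norm f \<le> 1}. ereal \<bar>restrict M A f\<bar>)"
      by (meson SUP_upper2)
  qed
  then show ?thesis
    unfolding invariant_mean_def using A one by (auto simp: add scale translate)
qed

section \<open>Uncountably many invariant means\<close>

theorem mainTheorem6: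
  shows "uncountable {m. invariant_mean Asp m}"
proof -
  obtain M where M: "bounded_mean M"
    and Mc: "\<And>f c. (\<And>k. 0 \<le> k \<Longrightarrow> f k = c) \<Longrightarrow> bounded (range f) \<Longrightarrow> M f = c"
    using ex_right_mean by blast
  define m where "m t f = t * M f + (1 - t) * M (\<lambda>k. f (- 1 - k))" for t f
  let ?h = "\<lambda>k::int. if 0 \<le> k then 1 else 0 :: real"
  have bdd: "bounded (range f)" if "f \<in> Asp" for f using that by (simp add: Asp_def)
  have mean: "invariant_mean Asp (restrict (m t) Asp)" if t: "t \<in> {0..1}" for t
  proof (rule bounded_mean_restrict)
    show "bounded_mean (m t)"
      unfolding m_def using t by (intro bounded_mean_convex M bounded_mean_reflect) auto
    have "M (\<lambda>_. 1) = 1" by (rule Mc) auto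
    then show "m t (\<lambda>_. 1) = 1" by (simp add: m_def)
  qed (simp_all add: bdd Asp_one Asp_add Asp_scale Asp_translate)
  have h: "m t ?h = t" for t
  proof -
    have "M ?h = 1" using Mc[OF _ bdd[OF Asp_half_line]] by simp
    moreover have "M (\<lambda>k. ?h (- 1 - k)) = 0"
    proof (rule Mc)
      show "bounded (range (\<lambda>k. ?h (- 1 - k)))" unfolding bounded_iff by (intro exI[of _ 1]) auto
    qed simp
    ultimately show ?thesis by (simp add: m_def)
  qed
  have "inj_on (\<lambda>t. restrict (m t) Asp) {0..1}"
  proof (rule inj_onI)
    fix s t :: real
    assume "restrict (m s) Asp = restrict (m t) Asp"
    then have "restrict (m s) Asp ?h = restrict (m t) Asp ?h" by (rule arg_cong)
    then show "s = t" by (simp add: Asp_half_line h)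
  qed
  then have "uncountable ((\<lambda>t. restrict (m t) Asp) ` {0..1})"
    using uncountable_closed_interval[of 0 1] countable_image_inj_on by auto
  moreover have "(\<lambda>t. restrict (m t) Asp) ` {0..1} \<subseteq> {m. invariant_mean Asp m}"
    using mean by blast
  ultimately show ?thesis using countable_subset by blast
qed

end
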